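(* For any set $\Gamma\cup\{\phi\}$ of $\mathbf{CPL}(\subseteq_0)$-formulas, $\Gamma\models\phi$ if and only if $\Gamma\vdash\phi$, where $\vdash$ is derivability in the natural deduction system of $\mathbf{CPL}(\subseteq_0)$.
   Context: Fix a set $\mathsf{Prop}$ of propositional variables. Classical formulas: $\alpha::=p\mid\bot\mid\top\mid\neg\alpha\mid(\alpha\wedge\alpha)\mid(\alpha\vee\alpha)$ with $p\in\mathsf{Prop}$. Formulas of $\mathbf{CPL}(\subseteq_0)$: $\phi::=p\mid\bot\mid\top\mid\neg\alpha\mid\mathsf x\subseteq\mathsf a\mid(\phi\wedge\phi)\mid(\phi\vee\phi)$ with $\alpha$ classical and $\mathsf x\subseteq\mathsf a$ a primitive inclusion atom: $\mathsf x=x_1\dots x_k$, $\mathsf a=a_1\dots a_k$ with $x_i\in\{\bot,\top\}$, $a_i\in\mathsf{Prop}\cup\{\bot,\top\}$ (empty sequences allowed). For $\mathsf N\subseteq\mathsf{Prop}$, a valuation on $\mathsf N$ is a function $v:\mathsf N\cup\{\bot,\top\}\to\{0,1\}$ with $v(\bot)=0$, $v(\top)=1$; an $\mathsf N$-team is a set $X$ of valuations on $\mathsf N$, with $\mathsf{dom}(X)=\mathsf N$ (the empty set is a team of any domain); $v(a_1\dots a_k)=\langle v(a_1),\dots,v(a_k)\rangle$. Team semantics, for $X$ whose domain contains the variables of $\phi$: $X\models p$ iff $v(p)=1$ for all $v\in X$; $X\models\bot$ iff $X=\emptyset$; $X\models\top$ always; $X\models\neg\alpha$ iff $\{v\}\not\models\alpha$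 for all $v\in X$; $X\models\phi\wedge\psi$ iff $X\models\phi$ and $X\models\psi$; $X\models\phi\vee\psi$ iff there are $Y,Z\subseteq X$ with $X=Y\cup Z$, $Y\models\phi$, $Z\models\psi$; $X\models\mathsf a\subseteq\mathsf b$ iff for all $v\in X$ there is $u\in X$ with $v(\mathsf a)=u(\mathsf b)$. $\Gamma\models\phi$ means: every team whose domain contains all variables of $\Gamma\cup\{\phi\}$ and which satisfies every $\gamma\in\Gamma$ satisfies $\phi$. Notation: $p^\top:=p$, $p^\bot:=\neg p$, $\top^\top:=\top$, $\bot^\bot:=\neg\bot$, $\top^\bot:=\bot^\top:=\bot$; $\mathsf a^{\mathsf x}:=a_1^{x_1}\wedge\dots\wedge a_k^{x_k}$ ($\top$ if $k=0$). Natural deduction system of $\mathbf{CPL}(\subseteq_0)$: $\Gamma\vdash\phi$ means there is a derivation of $\phi$ all of whose undischarged assumptions lie in $\Gamma$. In sequent notation, $\vdash$ is the least relation such that $\Gamma\vdash\phi$ for $\phi\in\Gamma$, $\Gamma\vdash\phi$ implies $\Gamma\cup\Gamma'\vdash\phi$, and which is closed under the following rules (all formulas being formulas of $\mathbf{CPL}(\subseteq_0)$), where $\alpha$ ranges over classical formulas, $\Gamma$ over sets of formulas, $\Delta$ over sets of classical formulas only, $\mathsf a,\mathsf b,\mathsf c,\mathsf d,\mathsf a',\dots$ over possibly empty sequences of elements of $\mathsf{Prop}\cup\{\top,\bot\}$ of matching lengths, $\mathsf x,\mathsf x_i$ over sequences of constants $\top,\bot$, and $p$ over variables: - $\top$I: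 $\Gamma\vdash\top$. $\neg$I: from $\Delta,\alpha\vdash\bot$ infer $\Delta\vdash\neg\alpha$. RAA: from $\Delta,\neg\alpha\vdash\bot$ infer $\Delta\vdash\alpha$. $\neg$E: from $\Gamma\vdash\alpha$, $\Gamma\vdash\neg\alpha$ infer $\Gamma\vdash\phi$. - $\wedge$I: from $\Gamma\vdash\phi$, $\Gamma\vdash\psi$ infer $\Gamma\vdash\phi\wedge\psi$. $\wedge$E: from $\Gamma\vdash\phi\wedge\psi$ infer $\Gamma\vdash\phi$, and infer $\Gamma\vdash\psi$. - $\vee$I: from $\Gamma\vdash\phi$ infer $\Gamma\vdash\phi\vee\psi$, and infer $\Gamma\vdash\psi\vee\phi$. $\vee$E: from $\Gamma\vdash\phi\vee\psi$, $\Delta,\phi\vdash\chi$, $\Delta,\psi\vdash\chi$ infer $\Gamma\cup\Delta\vdash\chi$. - $\subseteq$Exc: from $\Gamma\vdash\mathsf{abc}\subseteq\mathsf{a'b'c'}$ infer $\Gamma\vdash\mathsf{bac}\subseteq\mathsf{b'a'c'}$. $\subseteq$Ctr: from $\Gamma\vdash\mathsf{ab}\subseteq\mathsf{cd}$ infer $\Gamma\vdash\mathsf a\subseteq\mathsf c$. $\subseteq$Wk: from $\Gamma\vdash\mathsf{ab}\subseteq\mathsf{cd}$ infer $\Gamma\vdash\mathsf{aab}\subseteq\mathsf{ccd}$ (with $|\mathsf a|=|\mathsf a'|$, $|\mathsf b|=|\mathsf b'|$, resp. $|\mathsf a|=|\mathsf c|$). - $\subseteq$Trs: from $\Gamma\vdash\mathsf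 a\subseteq\mathsf b$, $\Gamma\vdash\mathsf b\subseteq\mathsf c$ infer $\Gamma\vdash\mathsf a\subseteq\mathsf c$. $\subseteq$Id: $\Gamma\vdash\mathsf a\subseteq\mathsf a$. - $\subseteq$Cmp: from $\Gamma\vdash\mathsf a\subseteq\mathsf b$ and $\Gamma\vdash\alpha(\mathsf b)$ infer $\Gamma\vdash\alpha(\mathsf a)$; here $\alpha(\mathsf b)$ and $\alpha(\mathsf a)$ are obtained from a classical formula $\alpha(r_1,\dots,r_k)$ whose only atoms are placeholder variables $r_1,\dots,r_k$ by substituting $b_i$, respectively $a_i$, for $r_i$. - $\subseteq_0$Ext: from $\Gamma\vdash\mathsf a\subseteq\mathsf b$ infer $\Gamma\vdash\top\mathsf a\subseteq\top\mathsf b$, and infer $\Gamma\vdash\bot\mathsf a\subseteq\bot\mathsf b$; from $\Gamma\vdash p$, $\Gamma\vdash\mathsf a\subseteq\mathsf b$ infer $\Gamma\vdash\top\mathsf a\subseteq p\mathsf b$; from $\Gamma\vdash\neg p$, $\Gamma\vdash\mathsf a\subseteq\mathsf b$ infer $\Gamma\vdash\bot\mathsf a\subseteq p\mathsf b$. - $\vee_{\subseteq_0}$E: from $\Gamma\vdash(\phi\wedge\mathsf x\subseteq\mathsf a)\vee\psi$, $\Gamma,\phi,\mathsf x\subseteq\mathsf a\vdash\chi$, $\Gamma,\psi\vdash\chi$ and $\Gamma,\phi\vee\psi,\mathsf x\subseteq\mathsf a\vdash\chi$ infer $\Gamma\vdash\chi$. - $\subseteq_0$Dst: from $\Gamma\vdash\phi\vee\psi$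 and $\Gamma\vdash\mathsf x_i\subseteq\mathsf a_i$ for $i=1,\dots,k$ infer $\Gamma\vdash\big((\phi\vee\mathsf a_1^{\mathsf x_1}\vee\dots\vee\mathsf a_k^{\mathsf x_k})\wedge\mathsf x_1\subseteq\mathsf a_1\wedge\dots\wedge\mathsf x_k\subseteq\mathsf a_k\big)\vee\psi$. *)

theory Defs
  imports "HOL-Library.FuncSet"
begin

text \<open>
  The set of propositional variables is the type \<open>'p\<close>. Truth values and the constants
  occurring in inclusion atoms are Booleans: \<open>True\<close> is \<open>\<top>\<close> (or 1), \<open>False\<close> is \<open>\<bottom>\<close> (or 0).
\<close>

datatype 'p atm = AVar 'p | Cst bool

datatype (cvars: 'p) cf =
    CVar 'p
  | CBot
  | CTop
  | CNeg "'p cf"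
  | CAnd "'p cf" "'p cf"
  | COr "'p cf" "'p cf"

text \<open>
  A primitive inclusion atom \<open>x\<^sub>1\<dots>x\<^sub>k \<subseteq> a\<^sub>1\<dots>a\<^sub>k\<close> is represented by the list of pairs
  \<open>[(x\<^sub>1, a\<^sub>1), \<dots>, (x\<^sub>k, a\<^sub>k)]\<close>, so the two sequences have the same length by construction.
  Negation applies to classical formulas only.
\<close>

datatype (vars: 'p) fm =
    Var 'p
  | Bot
  | Top
  | Neg "'p cf"
  | Incl "(bool \<times> 'p atm) list"
  | And "'p fm" "'p fm"
  | Or "'p fm" "'p fm"

text \<open>Classical formulas as formulas of the extended language.\<close>

primrec emb :: "'p cf \<Rightarrow> 'p fm" where
  "emb (CVar p) = Var p"
| "emb CBot = Bot"
| "emb CTop = Top"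
| "emb (CNeg \<alpha>) = Neg \<alpha>"
| "emb (CAnd \<alpha> \<beta>) = And (emb \<alpha>) (emb \<beta>)"
| "emb (COr \<alpha> \<beta>) = Or (emb \<alpha>) (emb \<beta>)"

lemma size_emb [simp]: "size (emb \<alpha>) = size \<alpha>"
  by (induction \<alpha>) simp_all


section \<open>Team semantics\<close>

text \<open>
  A valuation on \<open>N\<close> is an extensional function on \<open>N\<close> (its value outside \<open>N\<close> is
  \<open>undefined\<close>), so the valuations on \<open>N\<close> are in bijection with the functions from \<open>N\<close> to
  truth values.
\<close>

definition is_team :: "'p set \<Rightarrow> ('p \<Rightarrow> bool) set \<Rightarrow> bool" where
  "is_team N X \<longleftrightarrow> X \<subseteq> (N \<rightarrow>\<^sub>E UNIV)"

primrec val :: "('p \<Rightarrow> bool) \<Rightarrow> 'p atm \<Rightarrow> bool" where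
  "val v (AVar p) = v p"
| "val v (Cst x) = x"

function sat :: "('p \<Rightarrow> bool) set \<Rightarrow> 'p fm \<Rightarrow> bool" where
  "sat X (Var p) \<longleftrightarrow> (\<forall>v\<in>X. v p)"
| "sat X Bot \<longleftrightarrow> X = {}"
| "sat X Top \<longleftrightarrow> True"
| "sat X (Neg \<alpha>) \<longleftrightarrow> (\<forall>v\<in>X. \<not> sat {v} (emb \<alpha>))"
| "sat X (Incl A) \<longleftrightarrow>
     (\<forall>v\<in>X. \<exists>u\<in>X. map (\<lambda>(x, a). val v (Cst x)) A = map (\<lambda>(x, a). val u a) A)"
| "sat X (And \<phi> \<psi>) \<longleftrightarrow> sat X \<phi> \<and> sat X \<psi>"
| "sat X (Or \<phi> \<psi>) \<longleftrightarrow> (\<exists>Y Z. Y \<subseteq> X \<and> Z \<subseteq> X \<and> X = Y \<union> Z \<and> sat Y \<phi> \<and> sat Z \<psi>)"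
  by pat_completeness auto
termination
  by (relation "measure (\<lambda>(X, \<phi>). size \<phi>)") simp_all

definition entails :: "'p fm set \<Rightarrow> 'p fm \<Rightarrow> bool" (infix "\<Turnstile>" 50) where
  "\<Gamma> \<Turnstile> \<phi> \<longleftrightarrow>
     (\<forall>N X. is_team N X \<and> (\<Union>\<gamma>\<in>insert \<phi> \<Gamma>. vars \<gamma>) \<subseteq> N \<and> (\<forall>\<gamma>\<in>\<Gamma>. sat X \<gamma>) \<longrightarrow> sat X \<phi>)"


section \<open>Natural deduction\<close>

text \<open>The literals \<open>a\<^sup>x\<close>, and \<open>a\<^sub>1\<^sup>x\<^sup>1 \<and> \<dots> \<and> a\<^sub>k\<^sup>x\<^sup>k\<close> for the inclusion atom \<open>x \<subseteq> a\<close>.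
  Iterated conjunctions and disjunctions associate to the left.\<close>

fun lit :: "bool \<times> 'p atm \<Rightarrow> 'p cf" where
  "lit (True, AVar p) = CVar p"
| "lit (False, AVar p) = CNeg (CVar p)"
| "lit (True, Cst True) = CTop"
| "lit (False, Cst False) = CNeg CBot"
| "lit (False, Cst True) = CBot"
| "lit (True, Cst False) = CBot"

fun lits :: "(bool \<times> 'p atm) list \<Rightarrow> 'p cf" where
  "lits [] = CTop"
| "lits (b # A) = foldl CAnd (lit b) (map lit A)"

fun atm_cf :: "'p atm \<Rightarrow> 'p cf" where
  "atm_cf (AVar p) = CVar p"
| "atm_cf (Cst True) = CTop"
| "atm_cf (Cst False) = CBot"

text \<open>\<open>subst s \<alpha>\<close> replaces each variable \<open>r\<close> of \<open>\<alpha>\<close> by \<open>s r\<close>; in the compression rule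
  the placeholder variables are the natural numbers below the length of the sequences.\<close>

primrec subst :: "('r \<Rightarrow> 'p atm) \<Rightarrow> 'r cf \<Rightarrow> 'p cf" where
  "subst s (CVar r) = atm_cf (s r)"
| "subst s CBot = CBot"
| "subst s CTop = CTop"
| "subst s (CNeg \<alpha>) = CNeg (subst s \<alpha>)"
| "subst s (CAnd \<alpha> \<beta>) = CAnd (subst s \<alpha>) (subst s \<beta>)"
| "subst s (COr \<alpha> \<beta>) = COr (subst s \<alpha>) (subst s \<beta>)"

text \<open>
  Since all formulas must belong to the language, the left-hand side of every inclusion atom
  consists of constants. In particular, the middle sequence of \<open>IncTrs\<close> and the sequence of
  \<open>IncId\<close> are sequences of constants. Metavariables: \<open>\<alpha>\<close> is a classical formula, \<open>\<Delta>\<close> a set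
  of classical formulas, \<open>A\<close>, \<open>B\<close>, \<open>C\<close> are (parts of) inclusion atoms as lists of pairs, and
  \<open>As\<close> is a list of inclusion atoms.
\<close>

inductive derives :: "'p fm set \<Rightarrow> 'p fm \<Rightarrow> bool" (infix "\<turnstile>" 50) where
  Ax: "\<phi> \<in> \<Gamma> \<Longrightarrow> \<Gamma> \<turnstile> \<phi>"
| Weaken: "\<Gamma> \<turnstile> \<phi> \<Longrightarrow> \<Gamma> \<union> \<Gamma>' \<turnstile> \<phi>"
| TopI: "\<Gamma> \<turnstile> Top"
| NegI: "insert (emb \<alpha>) (emb ` \<Delta>) \<turnstile> Bot \<Longrightarrow> emb ` \<Delta> \<turnstile> Neg \<alpha>"
| RAA: "insert (Neg \<alpha>) (emb ` \<Delta>) \<turnstile> Bot \<Longrightarrow> emb ` \<Delta> \<turnstile> emb \<alpha>"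
| NegE: "\<Gamma> \<turnstile> emb \<alpha> \<Longrightarrow> \<Gamma> \<turnstile> Neg \<alpha> \<Longrightarrow> \<Gamma> \<turnstile> \<phi>"
| AndI: "\<Gamma> \<turnstile> \<phi> \<Longrightarrow> \<Gamma> \<turnstile> \<psi> \<Longrightarrow> \<Gamma> \<turnstile> And \<phi> \<psi>"
| AndE1: "\<Gamma> \<turnstile> And \<phi> \<psi> \<Longrightarrow> \<Gamma> \<turnstile> \<phi>"
| AndE2: "\<Gamma> \<turnstile> And \<phi> \<psi> \<Longrightarrow> \<Gamma> \<turnstile> \<psi>"
| OrI1: "\<Gamma> \<turnstile> \<phi> \<Longrightarrow> \<Gamma> \<turnstile> Or \<phi> \<psi>"
| OrI2: "\<Gamma> \<turnstile> \<phi> \<Longrightarrow> \<Gamma> \<turnstile> Or \<psi> \<phi>"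
| OrE: "\<Gamma> \<turnstile> Or \<phi> \<psi> \<Longrightarrow> insert \<phi> (emb ` \<Delta>) \<turnstile> \<chi> \<Longrightarrow> insert \<psi> (emb ` \<Delta>) \<turnstile> \<chi> \<Longrightarrow>
    \<Gamma> \<union> emb ` \<Delta> \<turnstile> \<chi>"
| IncExc: "\<Gamma> \<turnstile> Incl (A @ B @ C) \<Longrightarrow> \<Gamma> \<turnstile> Incl (B @ A @ C)"
| IncCtr: "\<Gamma> \<turnstile> Incl (A @ B) \<Longrightarrow> \<Gamma> \<turnstile> Incl A"
| IncWk: "\<Gamma> \<turnstile> Incl (A @ B) \<Longrightarrow> \<Gamma> \<turnstile> Incl (A @ A @ B)"
| IncTrs: "\<Gamma> \<turnstile> Incl (zip x (map Cst y)) \<Longrightarrow> \<Gamma> \<turnstile> Incl (zip y c) \<Longrightarrow>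
    length x = length y \<Longrightarrow> length y = length c \<Longrightarrow> \<Gamma> \<turnstile> Incl (zip x c)"
| IncId: "\<Gamma> \<turnstile> Incl (zip x (map Cst x))"
| IncCmp: "\<Gamma> \<turnstile> Incl (zip x b) \<Longrightarrow> \<Gamma> \<turnstile> emb (subst (\<lambda>i. b ! i) \<alpha>) \<Longrightarrow>
    length x = length b \<Longrightarrow> cvars \<alpha> \<subseteq> {..<length b} \<Longrightarrow>
    \<Gamma> \<turnstile> emb (subst (\<lambda>i. map Cst x ! i) \<alpha>)"
| ExtTop: "\<Gamma> \<turnstile> Incl A \<Longrightarrow> \<Gamma> \<turnstile> Incl ((True, Cst True) # A)"
| ExtBot: "\<Gamma> \<turnstile> Incl A \<Longrightarrow> \<Gamma> \<turnstile> Incl ((False, Cst False) # A)"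
| ExtPos: "\<Gamma> \<turnstile> Var p \<Longrightarrow> \<Gamma> \<turnstile> Incl A \<Longrightarrow> \<Gamma> \<turnstile> Incl ((True, AVar p) # A)"
| ExtNeg: "\<Gamma> \<turnstile> Neg (CVar p) \<Longrightarrow> \<Gamma> \<turnstile> Incl A \<Longrightarrow> \<Gamma> \<turnstile> Incl ((False, AVar p) # A)"
| OrIncE: "\<Gamma> \<turnstile> Or (And \<phi> (Incl A)) \<psi> \<Longrightarrow> insert \<phi> (insert (Incl A) \<Gamma>) \<turnstile> \<chi> \<Longrightarrow>
    insert \<psi> \<Gamma> \<turnstile> \<chi> \<Longrightarrow> insert (Or \<phi> \<psi>) (insert (Incl A) \<Gamma>) \<turnstile> \<chi> \<Longrightarrow> \<Gamma> \<turnstile> \<chi>"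
| IncDst: "\<Gamma> \<turnstile> Or \<phi> \<psi> \<Longrightarrow> (\<And>A. A \<in> set As \<Longrightarrow> \<Gamma> \<turnstile> Incl A) \<Longrightarrow>
    \<Gamma> \<turnstile> Or (foldl And (foldl Or \<phi> (map (\<lambda>A. emb (lits A)) As)) (map Incl As)) \<psi>"

end

theory Submission
  imports Defs
begin

text \<open>
  Soundness is an induction on derivations. It rests on three properties of the semantics:
  classical formulas are evaluated pointwise (\<open>sat_emb\<close>), every formula holds in the empty team,
  and the teams satisfying a formula are closed under unions (\<open>sat_Union\<close>), which is what
  \<open>\<or>\<close>-elimination needs.

  Completeness is a canonical model argument, made possible by the fact that a primitive
  inclusion atom \<open>x \<subseteq> a\<close> says of a nonempty team that some valuation in it satisfies the literals
  \<open>a\<^sup>x\<close>. Proof-theoretically, \<open>x \<subseteq> a\<close> and \<open>\<not>a\<^sup>x\<close> are contradictory (\<open>Incl_refute\<close>) and one may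
  argue by cases on them (\<open>Incl_cases\<close>). So if \<open>\<Gamma>\<close> does not derive \<open>\<chi>\<close>, a maximal extension of \<open>\<Gamma>\<close>
  that does not derive \<open>\<chi>\<close> contains, for every atom, the atom or the negation of its literals.
  Let \<open>X\<close> be the team of all valuations satisfying its classical members. By classical
  completeness, the extension contains the diagram of \<open>X\<close> over every finite list of variables:
  the atoms saying that the restrictions of elements of \<open>X\<close> occur, and the classical formula saying
  that no other restriction occurs (\<open>canonical_team\<close>).

  It remains to see that the diagram of a team over the variables of a formula decides the formula
  correctly: it derives the formula if the team satisfies it (\<open>diagram_derives\<close>), and is
  inconsistent with it otherwise (\<open>diagram_refutes\<close>). For \<open>\<phi> \<or> \<psi>\<close> the first part distributes the
  atoms of the two halves of the team into the disjunction by the rule \<open>\<subseteq>\<^sub>0\<close>Dst. The second part uses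
  that, by union closure, each team \<open>Y\<close> has a largest subteam satisfying \<open>\<phi>\<close>: from \<open>\<phi>\<close> and the
  classical description of \<open>Y\<close> one derives the classical description of that subteam, again by
  \<open>canonical_team\<close>. If \<open>Y\<close> does not satisfy \<open>\<phi> \<or> \<psi>\<close>, the two largest subteams miss some valuation
  of \<open>Y\<close>, against its atom in the diagram.

  The rules \<open>\<not>\<close>I, RAA and \<open>\<or>\<close>E admit only classical side assumptions, so that the
  admissibility of cut is not immediate; it is proved together with compactness in
  \<open>derives_supports\<close>.
\<close>

section \<open>Team semantics\<close>

primrec ceval :: "('p \<Rightarrow> bool) \<Rightarrow> 'p cf \<Rightarrow> bool" where
  "ceval v (CVar p) \<longleftrightarrow> v p"
| "ceval v CBot \<longleftrightarrow> False"
| "ceval v CTop \<longleftrightarrow> True"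
| "ceval v (CNeg \<alpha>) \<longleftrightarrow> \<not> ceval v \<alpha>"
| "ceval v (CAnd \<alpha> \<beta>) \<longleftrightarrow> ceval v \<alpha> \<and> ceval v \<beta>"
| "ceval v (COr \<alpha> \<beta>) \<longleftrightarrow> ceval v \<alpha> \<or> ceval v \<beta>"

lemma sat_emb: "sat X (emb \<alpha>) \<longleftrightarrow> (\<forall>v\<in>X. ceval v \<alpha>)"
proof (induction \<alpha> arbitrary: X)
  case (COr \<alpha> \<beta>)
  show ?case
  proof
    assume "\<forall>v\<in>X. ceval v (COr \<alpha> \<beta>)"
    then have "X = {v\<in>X. ceval v \<alpha>} \<union> {v\<in>X. ceval v \<beta>}" by auto
    moreover have "sat {v\<in>X. ceval v \<alpha>} (emb \<alpha>)" "sat {v\<in>X. ceval v \<beta>} (emb \<beta>)"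
      using COr by auto
    ultimately show "sat X (emb (COr \<alpha> \<beta>))"
      by (metis (no_types, lifting) emb.simps(6) sat.simps(7) sup_ge1 sup_ge2)
  qed (use COr in auto)
qed auto

lemma ceval_cong: "(\<And>p. p \<in> cvars \<alpha> \<Longrightarrow> v p = u p) \<Longrightarrow> ceval v \<alpha> = ceval u \<alpha>"
  by (induction \<alpha>) auto

lemma ceval_foldl_CAnd: "ceval v (foldl CAnd \<alpha> \<beta>s) \<longleftrightarrow> ceval v \<alpha> \<and> (\<forall>\<beta>\<in>set \<beta>s. ceval v \<beta>)"
  by (induction \<beta>s arbitrary: \<alpha>) auto

lemma ceval_foldl_COr: "ceval v (foldl COr \<alpha> \<beta>s) \<longleftrightarrow> ceval v \<alpha> \<or> (\<exists>\<beta>\<in>set \<beta>s. ceval v \<beta>)"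
  by (induction \<beta>s arbitrary: \<alpha>) auto

lemma ceval_lit: "ceval v (lit (x, a)) \<longleftrightarrow> val v a = x"
  by (cases "(x, a)" rule: lit.cases) auto

lemma ceval_lits: "ceval v (lits A) \<longleftrightarrow> (\<forall>(x, a)\<in>set A. val v a = x)"
  by (cases A) (auto simp: ceval_foldl_CAnd ceval_lit split: prod.splits)

lemma ceval_lits_zip:
  assumes "length x = length a"
  shows "ceval v (lits (zip x a)) \<longleftrightarrow> (\<forall>i<length a. val v (a ! i) = x ! i)"
  using assms by (fastforce simp: ceval_lits set_zip)

lemma ceval_subst: "ceval v (subst s \<alpha>) \<longleftrightarrow> ceval (\<lambda>r. val v (s r)) \<alpha>"
proof (induction \<alpha>)
  case (CVar r)
  show ?case by (cases "s r" rule: atm_cf.cases) auto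
qed auto

text \<open>In a nonempty team a primitive inclusion atom is the existential dual of a classical
  formula: some valuation of the team satisfies the literals of the atom.\<close>

lemma sat_Incl: "sat X (Incl A) \<longleftrightarrow> X = {} \<or> (\<exists>u\<in>X. ceval u (lits A))"
proof -
  have "map (\<lambda>(x, a). val v (Cst x)) A = map (\<lambda>(x, a). val u a) A \<longleftrightarrow> ceval u (lits A)"
    for v u :: "'a \<Rightarrow> bool"
    by (auto simp: ceval_lits)
  then show ?thesis by auto
qed

declare sat.simps(4,5) [simp del] lits.simps [simp del]

lemma sat_Incl_mono:
  assumes "sat X (Incl A)" "\<And>u. u \<in> X \<Longrightarrow> ceval u (lits A) \<Longrightarrow> ceval u (lits B)"
  shows "sat X (Incl B)"
  using assms by (auto simp: sat_Incl)

lemma sat_Neg: "sat X (Neg \<alpha>) \<longleftrightarrow> (\<forall>v\<in>X. \<not> ceval v \<alpha>)"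
  using sat_emb[of X "CNeg \<alpha>"] by simp

lemma sat_empty: "sat {} \<phi>"
  by (induction \<phi>) (auto simp: sat_Incl sat_Neg)

text \<open>The split of a union of teams required by a disjunction is the union of the
  splits of its members.\<close>

lemma sat_Union: "(\<And>X. X \<in> F \<Longrightarrow> sat X \<phi>) \<Longrightarrow> sat (\<Union>F) \<phi>"
proof (induction \<phi> arbitrary: F)
  case (Or \<phi> \<psi>)
  then have "\<forall>X\<in>F. \<exists>Y Z. X = Y \<union> Z \<and> sat Y \<phi> \<and> sat Z \<psi>" by fastforce
  then obtain f g where fg: "\<And>X. X \<in> F \<Longrightarrow> X = f X \<union> g X \<and> sat (f X) \<phi> \<and> sat (g X) \<psi>"
    by metis
  have "sat (\<Union>(f ` F)) \<phi>" "sat (\<Union>(g ` F)) \<psi>"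
    by (rule Or.IH; use fg in auto)+
  moreover have "\<Union>F = \<Union>(f ` F) \<union> \<Union>(g ` F)"
    using fg by blast
  ultimately show ?case by (metis sat.simps(7) sup_ge1 sup_ge2)
qed (auto simp: sat_Incl sat_Neg)

lemma sat_Un: "sat X \<phi> \<Longrightarrow> sat Y \<phi> \<Longrightarrow> sat (X \<union> Y) \<phi>"
  using sat_Union[of "{X, Y}" \<phi>] by auto

text \<open>The truth definition makes sense for arbitrary sets of total functions, and a team over a
  smaller domain is such a set. Hence only teams over all variables need to be considered.\<close>

lemma entails_iff: "\<Gamma> \<Turnstile> \<phi> \<longleftrightarrow> (\<forall>X. (\<forall>\<gamma>\<in>\<Gamma>. sat X \<gamma>) \<longrightarrow> sat X \<phi>)"
  unfolding entails_def is_team_def by (auto dest: spec[of _ UNIV])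

section \<open>Soundness\<close>

lemma sat_foldl_And:
  "sat X (foldl And \<phi> \<psi>s) \<longleftrightarrow> sat X \<phi> \<and> (\<forall>\<psi>\<in>set \<psi>s. sat X \<psi>)"
  by (induction \<psi>s arbitrary: \<phi>) auto

text \<open>The semantic content of the rule \<open>\<subseteq>\<^sub>0\<close>Dst: a team satisfying \<open>\<phi>\<close> may be enlarged by
  valuations that satisfy one of the added disjuncts.\<close>

lemma sat_foldl_Or:
  assumes "sat X \<phi>" "\<forall>v\<in>U. \<exists>\<alpha>\<in>set \<alpha>s. ceval v \<alpha>"
  shows "sat (X \<union> U) (foldl Or \<phi> (map emb \<alpha>s))"
  using assms
proof (induction \<alpha>s arbitrary: X U \<phi>)
  case (Cons \<alpha> \<alpha>s)
  let ?V = "{v\<in>U. ceval v \<alpha>}"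
  have "sat ?V (emb \<alpha>)" by (simp add: sat_emb)
  then have "sat (X \<union> ?V) (Or \<phi> (emb \<alpha>))"
    unfolding sat.simps using Cons.prems(1) by blast
  then have "sat ((X \<union> ?V) \<union> (U - ?V)) (foldl Or (Or \<phi> (emb \<alpha>)) (map emb \<alpha>s))"
    by (rule Cons.IH) (use Cons.prems(2) in auto)
  moreover have "(X \<union> ?V) \<union> (U - ?V) = X \<union> U" by auto
  ultimately show ?case by simp
qed auto

lemma soundness: "\<Gamma> \<turnstile> \<phi> \<Longrightarrow> \<forall>\<gamma>\<in>\<Gamma>. sat X \<gamma> \<Longrightarrow> sat X \<phi>"
proof (induction arbitrary: X rule: derives.induct)
  case (NegI \<alpha> \<Delta>)
  show ?case unfolding sat_Neg
  proof (intro ballI notI)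
    fix v assume "v \<in> X" "ceval v \<alpha>"
    then have "sat {v} Bot"
      using NegI.prems by (intro NegI.IH) (auto simp: sat_emb)
    then show False by simp
  qed
next
  case (RAA \<alpha> \<Delta>)
  show ?case unfolding sat_emb
  proof (intro ballI, rule ccontr)
    fix v assume "v \<in> X" "\<not> ceval v \<alpha>"
    then have "sat {v} Bot"
      using RAA.prems by (intro RAA.IH) (auto simp: sat_emb sat_Neg)
    then show False by simp
  qed
next
  case (NegE \<Gamma> \<alpha> \<phi>)
  then have "X = {}" unfolding sat_emb sat_Neg by blast
  then show ?case by (simp add: sat_empty)
next
  case (OrI1 \<Gamma> \<phi> \<psi>)
  then have "X \<subseteq> X \<and> {} \<subseteq> X \<and> X = X \<union> {} \<and> sat X \<phi> \<and> sat {} \<psi>"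
    by (simp add: sat_empty)
  then show ?case unfolding sat.simps by blast
next
  case (OrI2 \<Gamma> \<phi> \<psi>)
  then have "{} \<subseteq> X \<and> X \<subseteq> X \<and> X = {} \<union> X \<and> sat {} \<psi> \<and> sat X \<phi>"
    by (simp add: sat_empty)
  then show ?case unfolding sat.simps by blast
next
  case (OrE \<Gamma> \<phi> \<psi> \<Delta> \<chi>)
  then have "sat X (Or \<phi> \<psi>)" by blast
  then obtain Y Z where YZ: "X = Y \<union> Z" "sat Y \<phi>" "sat Z \<psi>" by auto
  have \<Delta>: "sat X (emb \<delta>)" if "\<delta> \<in> \<Delta>" for \<delta> using OrE.prems that by blast
  have "sat Y \<chi>"
    by (rule OrE.IH(2)) (use YZ \<Delta> in \<open>auto simp: sat_emb\<close>)
  moreover have "sat Z \<chi>"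
    by (rule OrE.IH(3)) (use YZ \<Delta> in \<open>auto simp: sat_emb\<close>)
  ultimately show ?case using YZ(1) sat_Un by blast
next
  case (IncTrs \<Gamma> x y c)
  show ?case
  proof (cases "X = {}")
    case False
    have "sat X (Incl (zip x (map Cst y)))" and sc: "sat X (Incl (zip y c))"
      using IncTrs by blast+
    then obtain u where "u \<in> X" "ceval u (lits (zip x (map Cst y)))"
      using False by (auto simp: sat_Incl)
    then have "x = y"
      using IncTrs.hyps(3,4) by (auto simp: ceval_lits_zip intro!: nth_equalityI)
    then show ?thesis using sc by simp
  qed (simp add: sat_empty)
next
  case (IncId \<Gamma> x)
  show ?case by (auto simp: sat_Incl ceval_lits_zip)
next
  case (IncCmp \<Gamma> x b \<alpha>)
  show ?case
  proof (cases "X = {}")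
    case False
    have "sat X (Incl (zip x b))" and \<alpha>: "sat X (emb (subst (\<lambda>i. b ! i) \<alpha>))"
      using IncCmp by blast+
    then obtain u where u: "u \<in> X" "ceval u (lits (zip x b))"
      using False by (auto simp: sat_Incl)
    have "ceval (\<lambda>i. val u (b ! i)) \<alpha>"
      using \<alpha> u(1) by (auto simp: sat_emb ceval_subst)
    moreover have "val u (b ! i) = x ! i" if "i < length b" for i
      using that u(2) IncCmp.hyps(3) by (simp add: ceval_lits_zip)
    ultimately have "ceval (\<lambda>i. val v (map Cst x ! i)) \<alpha>" if "v \<in> X" for v
      using IncCmp.hyps(3,4) by (subst ceval_cong[where u = "\<lambda>i. val u (b ! i)"]) auto
    then show ?thesis by (simp add: sat_emb ceval_subst)
  qed (simp add: sat_empty)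
next
  case (OrIncE \<Gamma> \<phi> A \<psi> \<chi>)
  have "sat X (Or (And \<phi> (Incl A)) \<psi>)" using OrIncE by blast
  then obtain Y Z where YZ: "X = Y \<union> Z" "sat Y \<phi>" "sat Y (Incl A)" "sat Z \<psi>"
    by auto
  show ?case
  proof (cases "Y = {}")
    case True
    then show ?thesis using YZ OrIncE by auto
  next
    case False
    then have "sat X (Incl A)" using YZ by (auto simp: sat_Incl)
    moreover have "sat X (Or \<phi> \<psi>)" using YZ by auto
    ultimately show ?thesis using OrIncE by blast
  qed
next
  case (IncDst \<Gamma> \<phi> \<psi> As)
  have "sat X (Or \<phi> \<psi>)" using IncDst by blast
  then obtain Y Z where YZ: "X = Y \<union> Z" "sat Y \<phi>" "sat Z \<psi>" by auto
  \<comment> \<open>The left part of the split is enlarged by all witnesses of the atoms in the team.\<close>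
  define U where "U = {u\<in>X. \<exists>A\<in>set As. ceval u (lits A)}"
  have "sat (Y \<union> U) (foldl Or \<phi> (map emb (map lits As)))"
    by (rule sat_foldl_Or) (use YZ in \<open>auto simp: U_def\<close>)
  moreover have "sat (Y \<union> U) (Incl A)" if A: "A \<in> set As" for A
  proof -
    have "sat X (Incl A)" using IncDst.IH(2) A IncDst.prems by blast
    then show ?thesis using YZ(1) A by (auto simp: sat_Incl U_def)
  qed
  ultimately have "sat (Y \<union> U)
      (foldl And (foldl Or \<phi> (map (\<lambda>A. emb (lits A)) As)) (map Incl As))"
    by (simp add: sat_foldl_And comp_def)
  moreover have "X = (Y \<union> U) \<union> Z" using YZ(1) by (auto simp: U_def)
  ultimately show ?case using YZ(3) by (metis sat.simps(7) sup_ge1 sup_ge2)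
next
  case IncExc
  show ?case by (rule sat_Incl_mono[OF IncExc.IH[OF IncExc.prems]]) (auto simp: ceval_lits)
next
  case IncCtr
  show ?case by (rule sat_Incl_mono[OF IncCtr.IH[OF IncCtr.prems]]) (auto simp: ceval_lits)
next
  case IncWk
  show ?case by (rule sat_Incl_mono[OF IncWk.IH[OF IncWk.prems]]) (auto simp: ceval_lits)
next
  case ExtTop
  show ?case by (rule sat_Incl_mono[OF ExtTop.IH[OF ExtTop.prems]]) (auto simp: ceval_lits)
next
  case ExtBot
  show ?case by (rule sat_Incl_mono[OF ExtBot.IH[OF ExtBot.prems]]) (auto simp: ceval_lits)
next
  case (ExtPos \<Gamma> p A)
  then have "sat X (Var p)" "sat X (Incl A)" by blast+
  then show ?case by (auto simp: sat_Incl ceval_lits)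
next
  case (ExtNeg \<Gamma> p A)
  then have "sat X (Neg (CVar p))" "sat X (Incl A)" by blast+
  then show ?case by (auto simp: sat_Incl sat_Neg ceval_lits)
qed auto

section \<open>Cut and compactness of derivability\<close>

lemma derives_mono: "\<Gamma> \<turnstile> \<phi> \<Longrightarrow> \<Gamma> \<subseteq> \<Gamma>' \<Longrightarrow> \<Gamma>' \<turnstile> \<phi>"
  by (metis Weaken Un_absorb1)

lemma Bot_elim:
  assumes "\<Gamma> \<turnstile> Bot" shows "\<Gamma> \<turnstile> \<phi>"
proof -
  have "emb ` {} \<turnstile> Neg CBot" by (rule NegI) (simp add: Ax)
  then have "\<Gamma> \<turnstile> Neg CBot" by (rule derives_mono) simp
  then show ?thesis using assms NegE[of \<Gamma> CBot] by simp
qed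

lemma Or_cut:
  assumes "\<Gamma> \<turnstile> Or \<phi> \<psi>" "{\<phi>} \<turnstile> \<chi>" "{\<psi>} \<turnstile> \<chi>" shows "\<Gamma> \<turnstile> \<chi>"
  using OrE[of \<Gamma> \<phi> \<psi> "{}" \<chi>] assms by simp

lemma single_cut: "\<Gamma> \<turnstile> \<phi> \<Longrightarrow> {\<phi>} \<turnstile> \<chi> \<Longrightarrow> \<Gamma> \<turnstile> \<chi>"
  by (blast intro: Or_cut OrI1)

lemma Incl_Nil: "\<Gamma> \<turnstile> Incl []"
  using IncId[of \<Gamma> "[]"] by simp

text \<open>A cut in an arbitrary context, since \<open>\<or>\<^bsub>\<subseteq>\<^sub>0\<^esub>\<close>E is the only rule whose discharging
  premises keep such a context. It is applied to \<open>(\<phi> \<and> [] \<subseteq> []) \<or> \<phi>\<close>, which is why the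
  conclusion must also be derived from \<open>\<phi> \<or> \<phi>\<close>.\<close>

lemma double_cut:
  assumes "\<Gamma> \<turnstile> \<phi>" "insert \<phi> \<Gamma> \<turnstile> \<chi>" "insert (Or \<phi> \<phi>) \<Gamma> \<turnstile> \<chi>" shows "\<Gamma> \<turnstile> \<chi>"
proof (rule OrIncE[where A = "[]"])
  show "\<Gamma> \<turnstile> Or (And \<phi> (Incl [])) \<phi>" by (intro OrI2 assms(1))
qed (use assms in \<open>auto intro: derives_mono\<close>)

lemma finite_conjunction:
  assumes "finite D" "D \<subseteq> range emb"
  shows "\<exists>\<delta>. \<forall>\<Gamma>. \<Gamma> \<turnstile> emb \<delta> \<longleftrightarrow> (\<forall>\<gamma>\<in>D. \<Gamma> \<turnstile> \<gamma>)"
  using assms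
proof (induction D rule: finite_induct)
  case empty
  show ?case by (rule exI[of _ CTop]) (auto intro: TopI)
next
  case (insert \<gamma> D)
  then obtain \<delta> \<beta> where "\<forall>\<Gamma>. \<Gamma> \<turnstile> emb \<delta> \<longleftrightarrow> (\<forall>\<gamma>\<in>D. \<Gamma> \<turnstile> \<gamma>)" "\<gamma> = emb \<beta>" by auto
  then show ?case by (intro exI[of _ "CAnd \<beta> \<delta>"]) (auto intro: AndI AndE1 AndE2)
qed

text \<open>Substituting derivations of arbitrary formulas for the classical side assumptions of a rule
  takes the rule out of its format. The remedy is to replace finitely many such assumptions by
  their conjunction, and thus the statement proved by induction has to provide finite sets.\<close>

definition supports :: "'p fm set \<Rightarrow> 'p fm \<Rightarrow> bool" where
  "supports G \<chi> \<longleftrightarrow> finite G \<and> (\<forall>\<Gamma>. (\<forall>\<gamma>\<in>G. \<Gamma> \<turnstile> \<gamma>) \<longrightarrow> \<Gamma> \<turnstile> \<chi>)"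

lemma supportsD: "supports G \<chi> \<Longrightarrow> (\<And>\<gamma>. \<gamma> \<in> G \<Longrightarrow> \<Gamma> \<turnstile> \<gamma>) \<Longrightarrow> \<Gamma> \<turnstile> \<chi>"
  by (auto simp: supports_def)

lemma supports1:
  assumes "\<exists>G\<subseteq>\<Gamma>. supports G \<phi>" "\<And>\<Gamma>. \<Gamma> \<turnstile> \<phi> \<Longrightarrow> \<Gamma> \<turnstile> \<chi>"
  shows "\<exists>G\<subseteq>\<Gamma>. supports G \<chi>"
  using assms unfolding supports_def by meson

lemma supports2:
  assumes "\<exists>G\<subseteq>\<Gamma>. supports G \<phi>" "\<exists>G\<subseteq>\<Gamma>. supports G \<psi>"
    "\<And>\<Gamma>. \<Gamma> \<turnstile> \<phi> \<Longrightarrow> \<Gamma> \<turnstile> \<psi> \<Longrightarrow> \<Gamma> \<turnstile> \<chi>"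
  shows "\<exists>G\<subseteq>\<Gamma>. supports G \<chi>"
proof -
  obtain G H where "G \<subseteq> \<Gamma>" "H \<subseteq> \<Gamma>" "supports G \<phi>" "supports H \<psi>" using assms(1,2) by blast
  then have "G \<union> H \<subseteq> \<Gamma> \<and> supports (G \<union> H) \<chi>" using assms(3) by (auto simp: supports_def)
  then show ?thesis by blast
qed

text \<open>For \<open>\<not>\<close>I and RAA, the rule is applied with the conjunction \<open>\<delta>\<close> of the finitely many
  side assumptions as its only one, and \<open>\<delta>\<close> is then cut by \<open>\<or>\<close>E from \<open>\<delta> \<or> \<delta>\<close>. For \<open>\<or>\<close>E itself the
  resulting context is no longer classical, and \<open>double_cut\<close> takes over: the argument works
  for \<open>\<delta> \<or> \<delta>\<close> in place of \<open>\<delta>\<close> because \<open>\<delta> \<or> \<delta>\<close> is classical as well.\<close>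

lemma derives_supports: "\<Gamma> \<turnstile> \<chi> \<Longrightarrow> \<exists>G\<subseteq>\<Gamma>. supports G \<chi>"
proof (induction rule: derives.induct)
  case (Ax \<phi> \<Gamma>)
  then show ?case by (intro exI[of _ "{\<phi>}"]) (auto simp: supports_def)
next
  case (Weaken \<Gamma> \<phi> \<Gamma>')
  then show ?case by blast
next
  case (TopI \<Gamma>)
  show ?case by (intro exI[of _ "{}"]) (auto simp: supports_def intro: derives.TopI)
next
  case (NegI \<alpha> \<Delta>)
  then obtain G where G: "G \<subseteq> insert (emb \<alpha>) (emb ` \<Delta>)" "supports G Bot" by blast
  let ?D = "G - {emb \<alpha>}"
  have D: "finite ?D" "?D \<subseteq> emb ` \<Delta>" using G by (auto simp: supports_def)
  then obtain \<delta> where \<delta>: "\<And>\<Gamma>. \<Gamma> \<turnstile> emb \<delta> \<longleftrightarrow> (\<forall>\<gamma>\<in>?D. \<Gamma> \<turnstile> \<gamma>)"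
    using finite_conjunction[of ?D] by blast
  have "insert (emb \<alpha>) (emb ` {\<delta>}) \<turnstile> emb \<delta>" by (simp add: Ax)
  then have "insert (emb \<alpha>) (emb ` {\<delta>}) \<turnstile> Bot"
    using \<delta> by (intro supportsD[OF G(2)]) (metis Ax Diff_iff insertI1 singletonD)
  from derives.NegI[OF this] have "{emb \<delta>} \<turnstile> Neg \<alpha>" by simp
  then have "supports ?D (Neg \<alpha>)"
    using D \<delta> by (auto simp: supports_def intro: single_cut)
  then show ?case using D by blast
next
  case (RAA \<alpha> \<Delta>)
  then obtain G where G: "G \<subseteq> insert (Neg \<alpha>) (emb ` \<Delta>)" "supports G Bot" by blast
  let ?D = "G - {Neg \<alpha>}"
  have D: "finite ?D" "?D \<subseteq> emb ` \<Delta>" using G by (auto simp: supports_def)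
  then obtain \<delta> where \<delta>: "\<And>\<Gamma>. \<Gamma> \<turnstile> emb \<delta> \<longleftrightarrow> (\<forall>\<gamma>\<in>?D. \<Gamma> \<turnstile> \<gamma>)"
    using finite_conjunction[of ?D] by blast
  have "insert (Neg \<alpha>) (emb ` {\<delta>}) \<turnstile> emb \<delta>" by (simp add: Ax)
  then have "insert (Neg \<alpha>) (emb ` {\<delta>}) \<turnstile> Bot"
    using \<delta> by (intro supportsD[OF G(2)]) (metis Ax Diff_iff insertI1 singletonD)
  from derives.RAA[OF this] have "{emb \<delta>} \<turnstile> emb \<alpha>" by simp
  then have "supports ?D (emb \<alpha>)"
    using D \<delta> by (auto simp: supports_def intro: single_cut)
  then show ?case using D by blast
next
  case (OrE \<Gamma> \<phi> \<psi> \<Delta> \<chi>)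
  then obtain G G1 G2 where G: "G \<subseteq> \<Gamma>" "supports G (Or \<phi> \<psi>)"
    and G1: "G1 \<subseteq> insert \<phi> (emb ` \<Delta>)" "supports G1 \<chi>"
    and G2: "G2 \<subseteq> insert \<psi> (emb ` \<Delta>)" "supports G2 \<chi>" by blast
  let ?D = "(G1 - {\<phi>}) \<union> (G2 - {\<psi>})"
  have D: "finite ?D" "?D \<subseteq> emb ` \<Delta>" using G1 G2 by (auto simp: supports_def)
  then obtain \<delta> where \<delta>: "\<And>\<Gamma>. \<Gamma> \<turnstile> emb \<delta> \<longleftrightarrow> (\<forall>\<gamma>\<in>?D. \<Gamma> \<turnstile> \<gamma>)"
    using finite_conjunction[of ?D] by blast
  \<comment> \<open>This is used both for \<open>\<epsilon> = \<delta>\<close> and for \<open>\<epsilon> = \<delta> \<or> \<delta>\<close>.\<close>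
  have from_conj: "insert \<phi> (emb ` {\<epsilon>}) \<turnstile> \<chi>" "insert \<psi> (emb ` {\<epsilon>}) \<turnstile> \<chi>"
    if "{emb \<epsilon>} \<turnstile> emb \<delta>" for \<epsilon>
  proof -
    have d: "\<Gamma> \<turnstile> \<gamma>" if "emb \<epsilon> \<in> \<Gamma>" "\<gamma> \<in> ?D" for \<Gamma> \<gamma>
      using \<delta>[of \<Gamma>] that \<open>{emb \<epsilon>} \<turnstile> emb \<delta>\<close> derives_mono[of "{emb \<epsilon>}" _ \<Gamma>] by blast
    show "insert \<phi> (emb ` {\<epsilon>}) \<turnstile> \<chi>"
    proof (rule supportsD[OF G1(2)])
      fix \<gamma> assume "\<gamma> \<in> G1"
      then show "insert \<phi> (emb ` {\<epsilon>}) \<turnstile> \<gamma>"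
        by (cases "\<gamma> = \<phi>") (auto intro: Ax d)
    qed
    show "insert \<psi> (emb ` {\<epsilon>}) \<turnstile> \<chi>"
    proof (rule supportsD[OF G2(2)])
      fix \<gamma> assume "\<gamma> \<in> G2"
      then show "insert \<psi> (emb ` {\<epsilon>}) \<turnstile> \<gamma>"
        by (cases "\<gamma> = \<psi>") (auto intro: Ax d)
    qed
  qed
  have "supports (G \<union> ?D) \<chi>"
    unfolding supports_def
  proof (intro conjI allI impI)
    show "finite (G \<union> ?D)" using D G by (auto simp: supports_def)
    fix \<Gamma>' assume \<Gamma>': "\<forall>\<gamma>\<in>G \<union> ?D. \<Gamma>' \<turnstile> \<gamma>"
    then have or: "\<Gamma>' \<turnstile> Or \<phi> \<psi>" and d: "\<Gamma>' \<turnstile> emb \<delta>"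
      using supportsD[OF G(2)] \<delta> by auto
    have "{emb \<delta>} \<turnstile> emb \<delta>" "{emb (COr \<delta> \<delta>)} \<turnstile> emb \<delta>"
      by (auto intro: Ax Or_cut)
    then have "\<Gamma>' \<union> emb ` {\<delta>} \<turnstile> \<chi>" "\<Gamma>' \<union> emb ` {COr \<delta> \<delta>} \<turnstile> \<chi>"
      by (blast intro: derives.OrE[OF or] from_conj)+
    then show "\<Gamma>' \<turnstile> \<chi>" by (intro double_cut[OF d]) auto
  qed
  then show ?case using G(1) D(2) by (intro exI[of _ "G \<union> ?D"]) auto
next
  case (OrIncE \<Gamma> \<phi> A \<psi> \<chi>)
  then obtain G G1 G2 G3 where G: "G \<subseteq> \<Gamma>" "supports G (Or (And \<phi> (Incl A)) \<psi>)"
    and G1: "G1 \<subseteq> insert \<phi> (insert (Incl A) \<Gamma>)" "supports G1 \<chi>"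
    and G2: "G2 \<subseteq> insert \<psi> \<Gamma>" "supports G2 \<chi>"
    and G3: "G3 \<subseteq> insert (Or \<phi> \<psi>) (insert (Incl A) \<Gamma>)" "supports G3 \<chi>" by metis
  let ?G = "G \<union> ((G1 \<union> G2 \<union> G3) \<inter> \<Gamma>)"
  have "supports ?G \<chi>"
    unfolding supports_def
  proof (intro conjI allI impI)
    show "finite ?G" using G G1 G2 G3 by (auto simp: supports_def)
    fix \<Gamma>' assume \<Gamma>': "\<forall>\<gamma>\<in>?G. \<Gamma>' \<turnstile> \<gamma>"
    have ext: "\<Gamma>'' \<turnstile> \<chi>"
      if H: "supports H \<chi>" "H \<subseteq> E \<union> \<Gamma>" "H \<inter> \<Gamma> \<subseteq> ?G" "E \<subseteq> \<Gamma>''" "\<Gamma>' \<subseteq> \<Gamma>''" for H E \<Gamma>''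
    proof (rule supportsD[OF H(1)])
      fix \<gamma> assume "\<gamma> \<in> H"
      then consider "\<gamma> \<in> E" | "\<gamma> \<in> ?G" using H(2,3) by blast
      then show "\<Gamma>'' \<turnstile> \<gamma>"
      proof cases
        case 1
        then show ?thesis using H(4) by (blast intro: Ax)
      next
        case 2
        then show ?thesis using \<Gamma>' H(5) derives_mono by blast
      qed
    qed
    show "\<Gamma>' \<turnstile> \<chi>"
    proof (rule derives.OrIncE)
      show "\<Gamma>' \<turnstile> Or (And \<phi> (Incl A)) \<psi>" using \<Gamma>' by (intro supportsD[OF G(2)]) auto
      show "insert \<phi> (insert (Incl A) \<Gamma>') \<turnstile> \<chi>"
        by (rule ext[OF G1(2), of "{\<phi>, Incl A}"]) (use G1 in auto)
      show "insert \<psi> \<Gamma>' \<turnstile> \<chi>"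
        by (rule ext[OF G2(2), of "{\<psi>}"]) (use G2 in auto)
      show "insert (Or \<phi> \<psi>) (insert (Incl A) \<Gamma>') \<turnstile> \<chi>"
        by (rule ext[OF G3(2), of "{Or \<phi> \<psi>, Incl A}"]) (use G3 in auto)
    qed
  qed
  then show ?case using G(1) by (intro exI[of _ ?G]) auto
next
  case (IncDst \<Gamma> \<phi> \<psi> As)
  from IncDst.IH(1) obtain G where G: "G \<subseteq> \<Gamma>" "supports G (Or \<phi> \<psi>)" by blast
  have "\<forall>A\<in>set As. \<exists>H. H \<subseteq> \<Gamma> \<and> supports H (Incl A)" using IncDst.IH(2) by blast
  then obtain H where H: "\<And>A. A \<in> set As \<Longrightarrow> H A \<subseteq> \<Gamma> \<and> supports (H A) (Incl A)"
    by metis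
  let ?G = "G \<union> (\<Union>A\<in>set As. H A)"
  have "supports ?G (Or (foldl And (foldl Or \<phi> (map (\<lambda>A. emb (lits A)) As)) (map Incl As)) \<psi>)"
    unfolding supports_def
  proof (intro conjI allI impI derives.IncDst)
    show "finite ?G" using G H by (auto simp: supports_def)
  next
    fix \<Gamma>' assume \<Gamma>': "\<forall>\<gamma>\<in>?G. \<Gamma>' \<turnstile> \<gamma>"
    show "\<Gamma>' \<turnstile> Or \<phi> \<psi>" using \<Gamma>' by (intro supportsD[OF G(2)]) auto
    fix A assume A: "A \<in> set As"
    show "\<Gamma>' \<turnstile> Incl A"
    proof (rule supportsD)
      show "supports (H A) (Incl A)" using H A by blast
      show "\<Gamma>' \<turnstile> \<gamma>" if "\<gamma> \<in> H A" for \<gamma> using \<Gamma>' A that by blast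
    qed
  qed
  then show ?case using G H by (intro exI[of _ ?G]) auto
next
  case (IncId \<Gamma> x)
  show ?case by (intro exI[of _ "{}"]) (auto simp: supports_def intro: derives.IncId)
next
  case NegE
  show ?case by (rule supports2[OF NegE.IH], rule derives.NegE)
next
  case AndI
  show ?case by (rule supports2[OF AndI.IH], rule derives.AndI)
next
  case IncTrs
  show ?case by (rule supports2[OF IncTrs.IH], rule derives.IncTrs[OF _ _ IncTrs.hyps(3,4)])
next
  case IncCmp
  show ?case by (rule supports2[OF IncCmp.IH], rule derives.IncCmp[OF _ _ IncCmp.hyps(3,4)])
next
  case ExtPos
  show ?case by (rule supports2[OF ExtPos.IH], rule derives.ExtPos)
next
  case ExtNeg
  show ?case by (rule supports2[OF ExtNeg.IH], rule derives.ExtNeg)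
next
  case AndE1
  show ?case by (rule supports1[OF AndE1.IH], rule derives.AndE1)
next
  case AndE2
  show ?case by (rule supports1[OF AndE2.IH], rule derives.AndE2)
next
  case OrI1
  show ?case by (rule supports1[OF OrI1.IH], rule derives.OrI1)
next
  case OrI2
  show ?case by (rule supports1[OF OrI2.IH], rule derives.OrI2)
next
  case IncExc
  show ?case by (rule supports1[OF IncExc.IH], rule derives.IncExc)
next
  case IncCtr
  show ?case by (rule supports1[OF IncCtr.IH], rule derives.IncCtr)
next
  case IncWk
  show ?case by (rule supports1[OF IncWk.IH], rule derives.IncWk)
next
  case ExtTop
  show ?case by (rule supports1[OF ExtTop.IH], rule derives.ExtTop)
next
  case ExtBot
  show ?case by (rule supports1[OF ExtBot.IH], rule derives.ExtBot)
qed

lemma derives_trans: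
  assumes "\<Gamma> \<turnstile> \<chi>" "\<And>\<gamma>. \<gamma> \<in> \<Gamma> \<Longrightarrow> \<Gamma>' \<turnstile> \<gamma>" shows "\<Gamma>' \<turnstile> \<chi>"
  using derives_supports[OF assms(1)] assms(2) unfolding supports_def by blast

lemma derives_cut: "\<Gamma> \<turnstile> \<phi> \<Longrightarrow> insert \<phi> \<Gamma> \<turnstile> \<chi> \<Longrightarrow> \<Gamma> \<turnstile> \<chi>"
  by (rule derives_trans) (auto intro: Ax)

lemma derives_finite: "\<Gamma> \<turnstile> \<chi> \<Longrightarrow> \<exists>G\<subseteq>\<Gamma>. finite G \<and> G \<turnstile> \<chi>"
  using derives_supports unfolding supports_def by (metis Ax)

section \<open>Classical completeness\<close>

text \<open>The parameter \<open>U\<close> restricts the formulas that are added: with classical formulas only, a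
  maximal consistent set determines a single valuation, whereas a maximal set of arbitrary formulas
  describes a whole team.\<close>

lemma lindenbaum:
  assumes "\<Gamma> \<subseteq> U" "\<not> \<Gamma> \<turnstile> \<phi>"
  obtains M where "\<Gamma> \<subseteq> M" "M \<subseteq> U" "\<not> M \<turnstile> \<phi>"
    "\<And>\<psi>. \<psi> \<in> U \<Longrightarrow> \<psi> \<notin> M \<Longrightarrow> insert \<psi> M \<turnstile> \<phi>"
proof -
  define \<A> where "\<A> = {M. \<Gamma> \<subseteq> M \<and> M \<subseteq> U \<and> \<not> M \<turnstile> \<phi>}"
  have "\<exists>M\<in>\<A>. \<forall>X\<in>\<A>. M \<subseteq> X \<longrightarrow> X = M"
  proof (rule subset_Zorn_nonempty)
    show "\<A> \<noteq> {}" using assms by (auto simp: \<A>_def)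
    fix C assume C: "C \<noteq> {}" "subset.chain \<A> C"
    have sub: "C \<subseteq> \<A>" using C(2) by (simp add: subset.chain_def)
    have "\<not> \<Union>C \<turnstile> \<phi>"
    proof
      assume "\<Union>C \<turnstile> \<phi>"
      then obtain G where "finite G" "G \<subseteq> \<Union>C" "G \<turnstile> \<phi>" using derives_finite by blast
      then obtain Y where "Y \<in> C" "G \<subseteq> Y"
        using finite_subset_Union_chain[OF _ _ C] by blast
      then have "Y \<turnstile> \<phi>" using \<open>G \<turnstile> \<phi>\<close> derives_mono by blast
      then show False using \<open>Y \<in> C\<close> sub by (auto simp: \<A>_def)
    qed
    then show "\<Union>C \<in> \<A>" using C(1) sub by (fastforce simp: \<A>_def)
  qed
  then obtain M where M: "M \<in> \<A>" "\<And>X. X \<in> \<A> \<Longrightarrow> M \<subseteq> X \<Longrightarrow> X = M" by blast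
  show thesis
  proof (rule that)
    show "insert \<psi> M \<turnstile> \<phi>" if "\<psi> \<in> U" "\<psi> \<notin> M" for \<psi>
      using M(2)[of "insert \<psi> M"] M(1) that by (auto simp: \<A>_def)
  qed (use M in \<open>auto simp: \<A>_def\<close>)
qed

lemma classical_completeness:
  assumes "\<And>v. (\<And>\<delta>. \<delta> \<in> \<Delta> \<Longrightarrow> ceval v \<delta>) \<Longrightarrow> ceval v \<alpha>"
  shows "emb ` \<Delta> \<turnstile> emb \<alpha>"
proof (rule ccontr)
  assume "\<not> emb ` \<Delta> \<turnstile> emb \<alpha>"
  then have "\<not> insert (Neg \<alpha>) (emb ` \<Delta>) \<turnstile> Bot" using RAA by blast
  moreover have "insert (Neg \<alpha>) (emb ` \<Delta>) \<subseteq> range emb"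
    using rangeI[of emb "CNeg \<alpha>"] by auto
  ultimately obtain M where M: "insert (Neg \<alpha>) (emb ` \<Delta>) \<subseteq> M" "M \<subseteq> range emb"
    "\<not> M \<turnstile> Bot" "\<And>\<psi>. \<psi> \<in> range emb \<Longrightarrow> \<psi> \<notin> M \<Longrightarrow> insert \<psi> M \<turnstile> Bot"
    by (metis lindenbaum)
  obtain \<Theta> where \<Theta>: "M = emb ` \<Theta>" using M(2) by (meson subset_imageE)
  define v where "v p \<longleftrightarrow> Var p \<in> M" for p
  have closed: "emb \<beta> \<in> M" if "M \<turnstile> emb \<beta>" for \<beta>
    using derives_cut[OF that] M(3,4) by blast
  have truth: "ceval v \<beta> \<longleftrightarrow> emb \<beta> \<in> M" for \<beta>
  proof (induction \<beta>)
    case CBot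
    show ?case using M(3) Ax by auto
  next
    case CTop
    show ?case using closed[of CTop] TopI by auto
  next
    case (CNeg \<beta>)
    have "emb (CNeg \<beta>) \<in> M" if "emb \<beta> \<notin> M"
      using NegI[of \<beta> \<Theta>] M(4)[of "emb \<beta>"] that closed[of "CNeg \<beta>"] \<Theta> by auto
    moreover have "emb \<beta> \<notin> M" if "Neg \<beta> \<in> M"
      using NegE[of M \<beta> Bot] M(3) that Ax by blast
    ultimately show ?case using CNeg by auto
  next
    case (CAnd \<beta> \<gamma>)
    have "M \<turnstile> And (emb \<beta>) (emb \<gamma>) \<longleftrightarrow> M \<turnstile> emb \<beta> \<and> M \<turnstile> emb \<gamma>"
      by (blast intro: AndI AndE1 AndE2)
    then show ?case using CAnd closed[of "CAnd \<beta> \<gamma>"] closed[of \<beta>] closed[of \<gamma>]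
      by (auto intro: Ax)
  next
    case (COr \<beta> \<gamma>)
    have "emb \<beta> \<in> M \<or> emb \<gamma> \<in> M" if "Or (emb \<beta>) (emb \<gamma>) \<in> M"
    proof (rule ccontr)
      assume "\<not> ?thesis"
      then have "insert (emb \<beta>) (emb ` \<Theta>) \<turnstile> Bot" "insert (emb \<gamma>) (emb ` \<Theta>) \<turnstile> Bot"
        using M(4) \<Theta> by auto
      then have "M \<union> emb ` \<Theta> \<turnstile> Bot" using OrE that Ax by blast
      then show False using M(3) \<Theta> by simp
    qed
    moreover have "M \<turnstile> Or (emb \<beta>) (emb \<gamma>)" if "emb \<beta> \<in> M \<or> emb \<gamma> \<in> M"
      using that Ax OrI1 OrI2 by blast
    ultimately show ?case using COr closed[of "COr \<beta> \<gamma>"] by auto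
  qed (auto simp: v_def)
  have "ceval v \<alpha>" by (rule assms) (use M(1) truth in auto)
  moreover have "\<not> ceval v \<alpha>" using truth[of "CNeg \<alpha>"] M(1) by auto
  ultimately show False by blast
qed

text \<open>Classical completeness and cut together make classical reasoning available in arbitrary
  contexts.\<close>

lemma classical_consequence:
  assumes "\<And>v. (\<And>\<delta>. \<Gamma> \<turnstile> emb \<delta> \<Longrightarrow> ceval v \<delta>) \<Longrightarrow> ceval v \<alpha>"
  shows "\<Gamma> \<turnstile> emb \<alpha>"
  by (rule derives_trans[OF classical_completeness[of "{\<delta>. \<Gamma> \<turnstile> emb \<delta>}"]])
    (use assms in auto)

lemma classical_consequence1:
  "\<Gamma> \<turnstile> emb \<delta> \<Longrightarrow> (\<And>v. ceval v \<delta> \<Longrightarrow> ceval v \<alpha>) \<Longrightarrow> \<Gamma> \<turnstile> emb \<alpha>"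
  by (rule classical_consequence) blast

section \<open>Inclusion atoms in derivations\<close>

lemma cvars_lits: "cvars (lits A) \<subseteq> {p. AVar p \<in> snd ` set A}"
proof -
  have foldl: "cvars (foldl CAnd \<alpha> \<beta>s) = cvars \<alpha> \<union> (\<Union>\<beta>\<in>set \<beta>s. cvars \<beta>)" for \<alpha> and \<beta>s :: "'a cf list"
    by (induction \<beta>s arbitrary: \<alpha>) auto
  have "cvars (lit b) \<subseteq> {p. AVar p = snd b}" for b :: "bool \<times> 'a atm"
    by (cases b rule: lit.cases) auto
  then show ?thesis by (cases A) (force simp: lits.simps foldl)+
qed

text \<open>By \<open>\<subseteq>\<close>Cmp, applied to the placeholder version of \<open>\<not>a\<^sup>x\<close>: it yields \<open>\<not>x\<^sup>x\<close>, which is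
  contradictory.\<close>

lemma Incl_refute:
  assumes "\<Gamma> \<turnstile> Incl A" "\<Gamma> \<turnstile> Neg (lits A)" shows "\<Gamma> \<turnstile> \<chi>"
proof -
  define n x b where "n = length A" and "x = map fst A" and "b = map snd A"
  have A: "A = zip x b" and len: "length x = n" "length b = n"
    by (simp_all add: x_def b_def n_def zip_map_fst_snd)
  \<comment> \<open>The placeholder variables are the positions in the atom.\<close>
  define \<alpha> where "\<alpha> = CNeg (lits (zip x (map AVar [0..<n])))"
  have ev: "ceval v (subst s \<alpha>) \<longleftrightarrow> \<not> (\<forall>i<n. val v (s i) = x ! i)" for v :: "'a \<Rightarrow> bool" and s
    by (simp add: \<alpha>_def ceval_subst ceval_lits_zip len)
  have "\<Gamma> \<turnstile> emb (subst (\<lambda>i. b ! i) \<alpha>)"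
    by (rule classical_consequence1[of _ "CNeg (lits A)"])
      (use assms(2) in \<open>auto simp: ev A ceval_lits_zip len\<close>)
  moreover have "cvars \<alpha> \<subseteq> {..<length b}"
    using cvars_lits[of "zip x (map AVar [0..<n])"] len by (auto simp: \<alpha>_def set_zip)
  moreover have "\<Gamma> \<turnstile> Incl (zip x b)" using assms(1) by (simp flip: A)
  ultimately have "\<Gamma> \<turnstile> emb (subst (\<lambda>i. map Cst x ! i) \<alpha>)"
    using IncCmp[of \<Gamma> x b \<alpha>] len by simp
  then have "\<Gamma> \<turnstile> emb CBot"
    by (rule classical_consequence1) (auto simp: ev len)
  then show ?thesis by (simp add: Bot_elim)
qed

text \<open>The extension rules build the atom entry by entry; an entry that pairs the two different
  constants makes the literals inconsistent.\<close>

lemma Incl_if_lits: "\<Gamma> \<turnstile> emb (lits A) \<Longrightarrow> \<Gamma> \<turnstile> Incl A"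
proof (induction A)
  case Nil
  show ?case by (rule Incl_Nil)
next
  case (Cons b A)
  have "\<Gamma> \<turnstile> emb (lits A)"
    by (rule classical_consequence1[OF Cons.prems]) (simp add: ceval_lits)
  then have A: "\<Gamma> \<turnstile> Incl A" by (rule Cons.IH)
  have b: "\<Gamma> \<turnstile> emb (lit b)"
    by (rule classical_consequence1[OF Cons.prems]) (cases b, simp add: ceval_lits ceval_lit)
  show ?case
    using A b by (cases b rule: lit.cases) (auto intro: ExtTop ExtBot ExtPos ExtNeg Bot_elim)
qed

lemma Or_mono:
  assumes "\<Gamma> \<turnstile> Or \<phi> \<psi>" "{\<phi>} \<turnstile> \<phi>'" "{\<psi>} \<turnstile> \<psi>'" shows "\<Gamma> \<turnstile> Or \<phi>' \<psi>'"
  using assms by (blast intro: Or_cut OrI1 OrI2)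

text \<open>From the tautology \<open>a\<^sup>x \<or> \<not>a\<^sup>x\<close> and \<open>Incl_if_lits\<close> one gets \<open>(a\<^sup>x \<and> x \<subseteq> a) \<or> \<not>a\<^sup>x\<close>, to which
  \<open>\<or>\<^bsub>\<subseteq>\<^sub>0\<^esub>\<close>E applies.\<close>

lemma Incl_cases:
  assumes "insert (Incl A) \<Gamma> \<turnstile> \<chi>" "insert (Neg (lits A)) \<Gamma> \<turnstile> \<chi>" shows "\<Gamma> \<turnstile> \<chi>"
proof (rule OrIncE)
  have "\<Gamma> \<turnstile> emb (COr (lits A) (CNeg (lits A)))" by (rule classical_consequence) simp
  then have "\<Gamma> \<turnstile> Or (emb (lits A)) (Neg (lits A))" by simp
  then show "\<Gamma> \<turnstile> Or (And (emb (lits A)) (Incl A)) (Neg (lits A))"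
    by (rule Or_mono) (auto intro: AndI Incl_if_lits Ax)
qed (use assms in \<open>auto intro: derives_mono\<close>)

text \<open>By cases on the target atom: if its literals are negated, so are those of the given one.
  This subsumes permuting, dropping, repeating entries and adding implied ones.\<close>

lemma Incl_mono:
  assumes "\<Gamma> \<turnstile> Incl A" "\<And>v. ceval v (lits A) \<Longrightarrow> ceval v (lits B)" shows "\<Gamma> \<turnstile> Incl B"
proof (rule Incl_cases)
  let ?\<Gamma> = "insert (Neg (lits B)) \<Gamma>"
  have "?\<Gamma> \<turnstile> emb (CNeg (lits B))" by (simp add: Ax)
  then have "?\<Gamma> \<turnstile> emb (CNeg (lits A))"
    by (rule classical_consequence1) (use assms(2) in auto)
  moreover have "?\<Gamma> \<turnstile> Incl A" using assms(1) by (rule derives_mono) auto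
  ultimately show "?\<Gamma> \<turnstile> Incl B" using Incl_refute[of ?\<Gamma> A] by simp
qed (simp add: Ax)

text \<open>The form of \<open>\<subseteq>\<^sub>0\<close>Dst used below: if the literals of the atoms imply \<open>\<theta>\<close>, the disjuncts that the
  rule adds to \<open>\<theta>\<close> are absorbed by it.\<close>

lemma Or_absorb_Incl:
  assumes or: "\<Gamma> \<turnstile> Or (emb \<theta>) \<psi>"
    and atoms: "\<And>A. A \<in> set As \<Longrightarrow> \<Gamma> \<turnstile> Incl A"
    and le: "\<And>A v. A \<in> set As \<Longrightarrow> ceval v (lits A) \<Longrightarrow> ceval v \<theta>"
    and \<phi>: "insert (emb \<theta>) (Incl ` set As) \<turnstile> \<phi>"
  shows "\<Gamma> \<turnstile> Or \<phi> \<psi>"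
proof -
  have emb: "foldl Or (emb \<alpha>) (map (\<lambda>A. emb (lits A)) Bs) = emb (foldl COr \<alpha> (map lits Bs))"
    for \<alpha> :: "'a cf" and Bs
    by (induction Bs arbitrary: \<alpha>) (simp_all flip: emb.simps)
  have conj: "\<Delta> \<turnstile> foldl And \<rho> \<sigma>s \<longleftrightarrow> \<Delta> \<turnstile> \<rho> \<and> (\<forall>\<sigma>\<in>set \<sigma>s. \<Delta> \<turnstile> \<sigma>)"
    for \<Delta> and \<rho> :: "'a fm" and \<sigma>s
    by (induction \<sigma>s arbitrary: \<rho>) (auto intro: AndI AndE1 AndE2)
  let ?\<theta> = "foldl COr \<theta> (map lits As)"
  let ?\<rho> = "foldl And (emb ?\<theta>) (map Incl As)"
  have "{?\<rho>} \<turnstile> ?\<rho>" by (simp add: Ax)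
  then have \<rho>: "{?\<rho>} \<turnstile> emb ?\<theta>" "\<And>A. A \<in> set As \<Longrightarrow> {?\<rho>} \<turnstile> Incl A"
    by (auto simp: conj)
  have "{?\<rho>} \<turnstile> emb \<theta>"
    using \<rho>(1) by (rule classical_consequence1) (use le in \<open>auto simp: ceval_foldl_COr\<close>)
  with \<rho>(2) have "{?\<rho>} \<turnstile> \<gamma>" if "\<gamma> \<in> insert (emb \<theta>) (Incl ` set As)" for \<gamma>
    using that by auto
  then have "{?\<rho>} \<turnstile> \<phi>" by (rule derives_trans[OF \<phi>])
  moreover have "\<Gamma> \<turnstile> Or ?\<rho> \<psi>"
    using IncDst[OF or atoms] by (simp add: emb)
  ultimately show ?thesis by (blast intro: Or_mono Ax)
qed

section \<open>Diagrams of teams\<close>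

definition agree :: "'p list \<Rightarrow> ('p \<Rightarrow> bool) \<Rightarrow> ('p \<Rightarrow> bool) \<Rightarrow> bool" where
  "agree vs u v \<longleftrightarrow> (\<forall>p\<in>set vs. u p = v p)"

lemma agree_refl [simp]: "agree vs u u"
  and agree_sym: "agree vs u v \<Longrightarrow> agree vs v u"
  and agree_trans: "agree vs u v \<Longrightarrow> agree vs v w \<Longrightarrow> agree vs u w"
  by (auto simp: agree_def)

lemma ceval_agree: "cvars \<alpha> \<subseteq> set vs \<Longrightarrow> agree vs u v \<Longrightarrow> ceval u \<alpha> = ceval v \<alpha>"
  by (rule ceval_cong) (auto simp: agree_def)

text \<open>The atom saying that the restriction of \<open>v\<close> to \<open>vs\<close> occurs in the team.\<close>

definition descr :: "'p list \<Rightarrow> ('p \<Rightarrow> bool) \<Rightarrow> (bool \<times> 'p atm) list" where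
  "descr vs v = map (\<lambda>p. (v p, AVar p)) vs"

lemma ceval_descr: "ceval u (lits (descr vs v)) \<longleftrightarrow> agree vs u v"
  by (auto simp: ceval_lits descr_def agree_def)

lemma finite_descr: "finite (descr vs ` Y)"
proof (rule finite_subset)
  show "descr vs ` Y \<subseteq> {A. set A \<subseteq> UNIV \<times> AVar ` set vs \<and> length A = length vs}"
    by (auto simp: descr_def)
qed (simp add: finite_lists_length_eq)

text \<open>Only finitely many restrictions to \<open>vs\<close> exist, so the valuations that agree on \<open>vs\<close> with a
  member of \<open>Y\<close> are definable by a classical formula, unique up to equivalence.\<close>

definition hull :: "'p list \<Rightarrow> ('p \<Rightarrow> bool) set \<Rightarrow> 'p cf" where
  "hull vs Y = (SOME \<theta>. \<forall>v. ceval v \<theta> \<longleftrightarrow> (\<exists>u\<in>Y. agree vs v u))"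

lemma ceval_hull: "ceval v (hull vs Y) \<longleftrightarrow> (\<exists>u\<in>Y. agree vs v u)"
proof -
  have "\<exists>\<theta>. \<forall>v. ceval v \<theta> \<longleftrightarrow> (\<exists>A\<in>S. ceval v (lits A))"
    if "finite S" for S :: "(bool \<times> 'a atm) list set"
    using that
  proof (induction S rule: finite_induct)
    case empty
    show ?case by (rule exI[of _ CBot]) simp
  next
    case (insert A S)
    then obtain \<theta> where "\<forall>v. ceval v \<theta> \<longleftrightarrow> (\<exists>A\<in>S. ceval v (lits A))" by blast
    then show ?case by (intro exI[of _ "COr (lits A) \<theta>"]) auto
  qed
  from this[OF finite_descr[of vs Y]]
  have "\<exists>\<theta>. \<forall>v. ceval v \<theta> \<longleftrightarrow> (\<exists>u\<in>Y. agree vs v u)" by (simp add: ceval_descr)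
  then show ?thesis unfolding hull_def by (rule someI2_ex) blast
qed

text \<open>A nonempty team satisfies the diagram exactly if it has the same restrictions to \<open>vs\<close> as \<open>Y\<close>.
  The empty team satisfies every diagram.\<close>

definition diagram :: "'p list \<Rightarrow> ('p \<Rightarrow> bool) set \<Rightarrow> 'p fm set" where
  "diagram vs Y = insert (emb (hull vs Y)) (Incl ` descr vs ` Y)"

lemma diagram_hull: "diagram vs Y \<subseteq> \<Gamma> \<Longrightarrow> \<Gamma> \<turnstile> emb (hull vs Y)"
  by (auto simp: diagram_def intro: Ax)

text \<open>A diagram asserts that the restriction of each of its valuations occurs, and so refutes any
  classical formula excluding that restriction.\<close>

lemma diagram_refute:
  assumes "diagram vs Y \<subseteq> \<Gamma>" "v \<in> Y" "\<Gamma> \<turnstile> emb \<alpha>"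
    "\<And>u. ceval u \<alpha> \<Longrightarrow> \<not> agree vs u v"
  shows "\<Gamma> \<turnstile> \<chi>"
proof (rule Incl_refute)
  show "\<Gamma> \<turnstile> Incl (descr vs v)" using assms(1,2) by (auto simp: diagram_def intro: Ax)
  have "\<Gamma> \<turnstile> emb (CNeg (lits (descr vs v)))"
    using assms(3) by (rule classical_consequence1) (use assms(4) in \<open>auto simp: ceval_descr\<close>)
  then show "\<Gamma> \<turnstile> Neg (lits (descr vs v))" by simp
qed

text \<open>The team of all classical models of a maximal set \<open>M\<close>. By compactness and completeness of
  classical logic, \<open>M\<close> proves the hull of this team. If the atom describing one of
  its members \<open>v\<close> were missing from \<open>M\<close>, then by \<open>Incl_cases\<close> the negated literals, which \<open>v\<close>
  falsifies, would belong to \<open>M\<close>.\<close>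

lemma canonical_team:
  assumes "\<not> \<Gamma> \<turnstile> \<chi>"
  obtains X where "\<not> \<Gamma> \<union> (\<Union>vs. diagram vs X) \<turnstile> \<chi>"
proof -
  obtain M where M: "\<Gamma> \<subseteq> M" "\<not> M \<turnstile> \<chi>" "\<And>\<psi>. \<psi> \<notin> M \<Longrightarrow> insert \<psi> M \<turnstile> \<chi>"
    using lindenbaum[of \<Gamma> UNIV \<chi>] assms by auto
  have closed: "\<psi> \<in> M" if "M \<turnstile> \<psi>" for \<psi>
    using derives_cut[OF that] M(2,3) by blast
  define X where "X = {v. \<forall>\<alpha>. emb \<alpha> \<in> M \<longrightarrow> ceval v \<alpha>}"
  have "diagram vs X \<subseteq> M" for vs
  proof -
    have "M \<turnstile> emb (hull vs X)"
    proof (rule classical_consequence)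
      fix v assume "\<And>\<delta>. M \<turnstile> emb \<delta> \<Longrightarrow> ceval v \<delta>"
      then have "v \<in> X" by (auto simp: X_def intro: Ax)
      then show "ceval v (hull vs X)" by (auto simp: ceval_hull intro: bexI[of _ v])
    qed
    moreover have "Incl (descr vs v) \<in> M" if "v \<in> X" for v
    proof (rule ccontr)
      assume "Incl (descr vs v) \<notin> M"
      then have "\<not> insert (Neg (lits (descr vs v))) M \<turnstile> \<chi>"
        using Incl_cases M(2,3) by blast
      then have "emb (CNeg (lits (descr vs v))) \<in> M" using M(3) by auto
      then show False using that unfolding X_def by (fastforce simp: ceval_descr)
    qed
    ultimately show ?thesis using closed by (auto simp: diagram_def)
  qed
  then have "\<Gamma> \<union> (\<Union>vs. diagram vs X) \<subseteq> M" using M(1) by blast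
  then show thesis using that M(2) derives_mono by blast
qed

section \<open>Completeness\<close>

lemma cvars_lits_vars: "cvars (lits A) \<subseteq> vars (Incl A)"
  using cvars_lits[of A] by (force elim!: snds.cases)

lemma diagram_derives:
  "sat Y \<psi> \<Longrightarrow> vars \<psi> \<subseteq> set vs \<Longrightarrow> diagram vs Y \<turnstile> \<psi>"
proof (induction \<psi> arbitrary: Y)
  have classical: "diagram vs Y \<turnstile> emb \<alpha>" if "sat Y (emb \<alpha>)" "cvars \<alpha> \<subseteq> set vs" for \<alpha> Y
    by (rule classical_consequence1[OF diagram_hull[OF order_refl]])
      (use that in \<open>auto simp: ceval_hull sat_emb ceval_agree\<close>)
  {
    case (Var p)
    then show ?case using classical[of Y "CVar p"] by simp
  next
    case Bot
    then show ?case using classical[of Y "CBot"] by simp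
  next
    case Top
    then show ?case by (simp add: TopI)
  next
    case (Neg \<alpha>)
    then show ?case using classical[of Y "CNeg \<alpha>"] by simp
  next
    case (Incl A)
    show ?case
    proof (cases "Y = {}")
      case True
      then show ?thesis using classical[of Y CBot] by (simp add: Bot_elim)
    next
      case False
      then obtain u where u: "u \<in> Y" "ceval u (lits A)"
        using Incl.prems(1) by (auto simp: sat_Incl)
      have "diagram vs Y \<turnstile> Incl (descr vs u)" using u(1) by (auto simp: diagram_def intro: Ax)
      then show ?thesis
      proof (rule Incl_mono)
        fix v assume "ceval v (lits (descr vs u))"
        then show "ceval v (lits A)"
          using u(2) cvars_lits_vars[of A] Incl.prems(2) ceval_agree[of "lits A" vs v u]
          by (auto simp: ceval_descr)
      qed
    qed
  next
    case (And \<phi> \<psi>)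
    then show ?case by (auto intro: AndI)
  next
    case (Or \<phi> \<psi>)
    then obtain Y1 Y2 where Y: "Y = Y1 \<union> Y2" and "sat Y1 \<phi>" "sat Y2 \<psi>" by auto
    then have d: "diagram vs Y1 \<turnstile> \<phi>" "diagram vs Y2 \<turnstile> \<psi>" using Or by auto
    let ?D = "diagram vs Y"
    \<comment> \<open>A hull in a disjunction collects the atoms of its team, which are members of \<open>?D\<close>.\<close>
    have absorb: "?D \<turnstile> Or \<xi> \<rho>"
      if "?D \<turnstile> Or (emb (hull vs Z)) \<rho>" "Z \<subseteq> Y" "diagram vs Z \<turnstile> \<xi>" for Z \<rho> \<xi>
    proof -
      obtain As where As: "set As = descr vs ` Z" using finite_list[OF finite_descr] by blast
      show ?thesis
      proof (rule Or_absorb_Incl[OF that(1), of As])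
        show "insert (emb (hull vs Z)) (Incl ` set As) \<turnstile> \<xi>"
          using that(3) by (simp add: As diagram_def)
        show "?D \<turnstile> Incl A" if "A \<in> set As" for A
          using that \<open>Z \<subseteq> Y\<close> by (auto simp: As diagram_def intro!: Ax)
        show "ceval v (hull vs Z)" if "A \<in> set As" "ceval v (lits A)" for A v
          using that by (auto simp: As ceval_descr ceval_hull)
      qed
    qed
    have swap: "?D \<turnstile> Or \<rho> \<xi>" if "?D \<turnstile> Or \<xi> \<rho>" for \<xi> \<rho>
      using that by (rule Or_cut) (auto intro: OrI1 OrI2 Ax)
    have "?D \<turnstile> emb (COr (hull vs Y1) (hull vs Y2))"
      by (rule classical_consequence1[OF diagram_hull[OF order_refl]])
        (auto simp: ceval_hull Y)
    then have "?D \<turnstile> Or (emb (hull vs Y1)) (emb (hull vs Y2))" by simp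
    then have "?D \<turnstile> Or \<phi> (emb (hull vs Y2))" by (rule absorb) (use d(1) Y in auto)
    then have "?D \<turnstile> Or (emb (hull vs Y2)) \<phi>" by (rule swap)
    then have "?D \<turnstile> Or \<psi> \<phi>" by (rule absorb) (use d(2) Y in auto)
    then show ?case by (rule swap)
  }
qed

text \<open>The diagram of \<open>X\<close> derives \<open>\<psi>\<close> and also holds in \<open>Y\<close>, so locality follows from
  soundness.\<close>

lemma sat_locality:
  assumes "sat X \<psi>" "vars \<psi> \<subseteq> set vs"
    and XY: "\<And>x. x \<in> X \<Longrightarrow> \<exists>y\<in>Y. agree vs y x" "\<And>y. y \<in> Y \<Longrightarrow> \<exists>x\<in>X. agree vs y x"
  shows "sat Y \<psi>"
proof (rule soundness[OF diagram_derives[OF assms(1,2)]])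
  show "\<forall>\<gamma>\<in>diagram vs X. sat Y \<gamma>"
    using XY by (auto simp: diagram_def sat_emb sat_Incl ceval_hull ceval_descr)
qed

definition largest_subteam :: "'p fm \<Rightarrow> ('p \<Rightarrow> bool) set \<Rightarrow> ('p \<Rightarrow> bool) set" where
  "largest_subteam \<psi> Y = \<Union>{Z. Z \<subseteq> Y \<and> sat Z \<psi>}"

lemma largest_subteam_subset: "largest_subteam \<psi> Y \<subseteq> Y"
  by (auto simp: largest_subteam_def)

lemma sat_largest_subteam: "sat (largest_subteam \<psi> Y) \<psi>"
  unfolding largest_subteam_def by (rule sat_Union) auto

lemma subset_largest_subteam: "Z \<subseteq> Y \<Longrightarrow> sat Z \<psi> \<Longrightarrow> Z \<subseteq> largest_subteam \<psi> Y"
  by (auto simp: largest_subteam_def)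

text \<open>Otherwise there is a canonical team \<open>X\<close> for the two assumptions. It satisfies \<open>\<psi>\<close>, since its
  diagram is consistent with \<open>\<psi>\<close>, and up to agreement on \<open>vs\<close> it is a subteam of \<open>Y\<close>. Hence it
  lies within the largest subteam, and its own hull already implies the conclusion.\<close>

lemma derives_hull_largest_subteam:
  assumes vars: "vars \<psi> \<subseteq> set vs"
    and inconsistent: "\<And>Z \<chi>. \<not> sat Z \<psi> \<Longrightarrow> insert \<psi> (diagram vs Z) \<turnstile> \<chi>"
  shows "{\<psi>, emb (hull vs Y)} \<turnstile> emb (hull vs (largest_subteam \<psi> Y))"
    (is "?\<Gamma> \<turnstile> ?\<chi>")
proof (rule ccontr)
  assume "\<not> ?\<Gamma> \<turnstile> ?\<chi>"
  then obtain X where X: "\<not> ?\<Gamma> \<union> (\<Union>vs. diagram vs X) \<turnstile> ?\<chi>" by (rule canonical_team)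
  let ?G = "?\<Gamma> \<union> (\<Union>vs. diagram vs X)"
  have diag: "diagram vs X \<subseteq> ?G" by blast
  have satX: "sat X \<psi>"
  proof (rule ccontr)
    assume "\<not> sat X \<psi>"
    then have "?G \<turnstile> ?\<chi>" by (rule derives_mono[OF inconsistent]) blast
    then show False using X by blast
  qed
  have near: "\<exists>y\<in>Y. agree vs x y" if "x \<in> X" for x
  proof (rule ccontr)
    assume far: "\<not> ?thesis"
    have "?G \<turnstile> emb (hull vs Y)" by (simp add: Ax)
    then have "?G \<turnstile> ?\<chi>"
      by (rule diagram_refute[OF diag that])
        (use far agree_sym agree_trans in \<open>unfold ceval_hull, blast\<close>)
    then show False using X by blast
  qed
  let ?Z = "{y\<in>Y. \<exists>x\<in>X. agree vs y x}"
  have "sat ?Z \<psi>"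
  proof (rule sat_locality[OF satX vars])
    show "\<exists>y\<in>?Z. agree vs y x" if "x \<in> X" for x
      using near[OF that] that agree_sym by blast
  qed auto
  then have Z: "?Z \<subseteq> largest_subteam \<psi> Y" by (intro subset_largest_subteam) auto
  have "?G \<turnstile> ?\<chi>"
  proof (rule classical_consequence1[OF diagram_hull[OF diag]])
    fix v assume "ceval v (hull vs X)"
    then obtain x where "x \<in> X" "agree vs v x" by (auto simp: ceval_hull)
    moreover from near[OF this(1)] obtain y where "y \<in> Y" "agree vs x y" by blast
    ultimately have "y \<in> largest_subteam \<psi> Y" "agree vs v y"
      using Z agree_sym agree_trans by blast+
    then show "ceval v (hull vs (largest_subteam \<psi> Y))" by (auto simp: ceval_hull)
  qed
  then show False using X by blast
qed

lemma diagram_refutes: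
  "\<not> sat Y \<psi> \<Longrightarrow> vars \<psi> \<subseteq> set vs \<Longrightarrow> insert \<psi> (diagram vs Y) \<turnstile> \<chi>"
proof (induction \<psi> arbitrary: Y \<chi>)
  have classical: "insert (emb \<alpha>) (diagram vs Y) \<turnstile> \<chi>"
    if \<alpha>: "\<not> sat Y (emb \<alpha>)" "cvars \<alpha> \<subseteq> set vs" for \<alpha> Y \<chi>
  proof -
    obtain v where v: "v \<in> Y" "\<not> ceval v \<alpha>" using \<alpha>(1) by (auto simp: sat_emb)
    show ?thesis
      by (rule diagram_refute[of vs Y _ v \<alpha>])
        (use v ceval_agree[OF \<alpha>(2)] in \<open>auto intro: Ax\<close>)
  qed
  {
    case (Var p)
    then show ?case using classical[of Y "CVar p"] by simp
  next
    case Bot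
    then show ?case using classical[of Y "CBot"] by simp
  next
    case Top
    then show ?case by simp
  next
    case (Neg \<alpha>)
    then show ?case using classical[of Y "CNeg \<alpha>"] by simp
  next
    case (Incl A Y \<chi>)
    let ?G = "insert (Incl A) (diagram vs Y)"
    have "?G \<turnstile> emb (hull vs Y)" by (rule diagram_hull) blast
    then have "?G \<turnstile> emb (CNeg (lits A))"
    proof (rule classical_consequence1)
      fix v assume "ceval v (hull vs Y)"
      then show "ceval v (CNeg (lits A))"
        using Incl.prems cvars_lits_vars[of A] ceval_agree[of "lits A" vs v]
        by (auto simp: ceval_hull sat_Incl)
    qed
    then show ?case using Incl_refute[of ?G A \<chi>] Ax[of "Incl A" ?G] by simp
  next
    case (And \<phi> \<psi> Y \<chi>)
    let ?G = "insert (And \<phi> \<psi>) (diagram vs Y)"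
    have "?G \<turnstile> And \<phi> \<psi>" by (simp add: Ax)
    then have "?G \<turnstile> \<phi>" "?G \<turnstile> \<psi>" by (blast intro: AndE1 AndE2)+
    moreover have "insert \<phi> ?G \<turnstile> \<chi> \<or> insert \<psi> ?G \<turnstile> \<chi>"
      using And derives_mono[of "insert \<phi> (diagram vs Y)" \<chi> "insert \<phi> ?G"]
        derives_mono[of "insert \<psi> (diagram vs Y)" \<chi> "insert \<psi> ?G"] by auto
    ultimately show ?case by (blast intro: derives_cut)
  next
    case (Or \<phi> \<psi> Y \<chi>)
    let ?G = "insert (Or \<phi> \<psi>) (diagram vs Y)"
    \<comment> \<open>Since \<open>hull vs Y\<close> is classical, it may serve as side assumption of \<open>\<or>\<close>E.\<close>
    let ?Y1 = "largest_subteam \<phi> Y" and ?Y2 = "largest_subteam \<psi> Y"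
    have "{\<phi>, emb (hull vs Y)} \<turnstile> emb (hull vs ?Y1)" "{\<psi>, emb (hull vs Y)} \<turnstile> emb (hull vs ?Y2)"
      using Or by (auto intro!: derives_hull_largest_subteam)
    then have "insert \<phi> (emb ` {hull vs Y}) \<turnstile> emb (COr (hull vs ?Y1) (hull vs ?Y2))"
      "insert \<psi> (emb ` {hull vs Y}) \<turnstile> emb (COr (hull vs ?Y1) (hull vs ?Y2))"
      by (auto intro: OrI1 OrI2)
    then have "{Or \<phi> \<psi>} \<union> emb ` {hull vs Y} \<turnstile> emb (COr (hull vs ?Y1) (hull vs ?Y2))"
      by (rule OrE[OF Ax[OF singletonI]])
    then have hulls: "?G \<turnstile> emb (COr (hull vs ?Y1) (hull vs ?Y2))"
      by (rule derives_mono) (auto simp: diagram_def)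
    have "?Y1 \<union> ?Y2 \<noteq> Y"
      using Or.prems(1) sat_largest_subteam by (metis sat.simps(7) sup_ge1 sup_ge2)
    then obtain v where v: "v \<in> Y" "v \<notin> ?Y1" "v \<notin> ?Y2"
      using largest_subteam_subset by blast
    \<comment> \<open>Adding \<open>v\<close> next to an agreeing member would enlarge the largest subteam.\<close>
    have far: "\<not> agree vs u v"
      if "vars \<xi> \<subseteq> set vs" "v \<notin> largest_subteam \<xi> Y" "u \<in> largest_subteam \<xi> Y" for u \<xi>
    proof
      assume "agree vs u v"
      then have "sat (insert v (largest_subteam \<xi> Y)) \<xi>"
        using that(3) by (intro sat_locality[OF sat_largest_subteam that(1)])
          (auto intro: agree_sym agree_refl)
      then have "insert v (largest_subteam \<xi> Y) \<subseteq> largest_subteam \<xi> Y"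
        using v(1) largest_subteam_subset by (intro subset_largest_subteam) auto
      then show False using that(2) by blast
    qed
    show ?case
    proof (rule diagram_refute[OF _ v(1) hulls])
      fix u assume "ceval u (COr (hull vs ?Y1) (hull vs ?Y2))"
      then obtain w where "w \<in> ?Y1 \<or> w \<in> ?Y2" "agree vs u w" by (auto simp: ceval_hull)
      moreover from this have "\<not> agree vs w v"
        using far[of \<phi> w] far[of \<psi> w] v(2,3) Or.prems(2) by auto
      ultimately show "\<not> agree vs u v" using agree_sym agree_trans by blast
    qed auto
  }
qed

lemma finite_vars: "finite (vars \<phi>)"
proof -
  have c: "finite (cvars \<alpha>)" for \<alpha> :: "'a cf" by (induction \<alpha>) auto
  have a: "finite (set_atm a)" for a :: "'a atm" by (cases a) auto
  have "finite (\<Union> (set_atm ` Basic_BNFs.snds x))" for x :: "bool \<times> 'a atm"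
    by (cases x) (simp add: a)
  then show ?thesis by (induction \<phi>) (auto simp: c a)
qed

lemma completeness:
  assumes "\<And>X. (\<And>\<gamma>. \<gamma> \<in> \<Gamma> \<Longrightarrow> sat X \<gamma>) \<Longrightarrow> sat X \<phi>"
  shows "\<Gamma> \<turnstile> \<phi>"
proof (rule ccontr)
  assume "\<not> \<Gamma> \<turnstile> \<phi>"
  then obtain X where X: "\<not> \<Gamma> \<union> (\<Union>vs. diagram vs X) \<turnstile> \<phi>" by (rule canonical_team)
  have "sat X \<gamma>" if \<gamma>: "\<gamma> \<in> \<Gamma>" for \<gamma>
  proof (rule ccontr)
    assume "\<not> sat X \<gamma>"
    moreover obtain vs where "set vs = vars \<gamma>"
      using finite_list[OF finite_vars[of \<gamma>]] by auto
    ultimately have "insert \<gamma> (diagram vs X) \<turnstile> \<phi>" by (simp add: diagram_refutes)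
    then have "\<Gamma> \<union> (\<Union>vs. diagram vs X) \<turnstile> \<phi>" by (rule derives_mono) (use \<gamma> in auto)
    then show False using X by blast
  qed
  then have "sat X \<phi>" by (rule assms)
  moreover obtain vs where "set vs = vars \<phi>"
      using finite_list[OF finite_vars[of \<phi>]] by auto
  ultimately have "diagram vs X \<turnstile> \<phi>" by (simp add: diagram_derives)
  then have "\<Gamma> \<union> (\<Union>vs. diagram vs X) \<turnstile> \<phi>" by (rule derives_mono) blast
  then show False using X by blast
qed

theorem theorem4p15:
  fixes \<Gamma> :: "'p fm set" and \<phi> :: "'p fm"
  shows "\<Gamma> \<Turnstile> \<phi> \<longleftrightarrow> \<Gamma> \<turnstile> \<phi>"
  unfolding entails_iff using soundness completeness by metis

end
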